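(* For every integer $k>0$, there is a Las Vegas unitary (measure-once) quantum finite automaton with $2\cdot 2^k$ states that recognizes $\mathtt{MODXOR}_k$ with success probability $1/2$.
   Context: For $k>0$, $\mathtt{MODXOR}_k\subseteq\{0,1\}^*$ is the set of strings of the form $w_0\,x_1\,u_1\,x_2\,u_2\cdots x_m\,u_m$ where $m>0$, $w_0\in\{0,1\}^*$ has length less than $2k$, each $x_i\in\{0,1\}$, each $u_i\in\{0,1\}^{2k-1}$, and $x_1\oplus\cdots\oplus x_m=1$. A unitary finite automaton (UFA, Moore–Crutchfield/measure-once QFA) with state set $Q=\{q_1,\dots,q_m\}$ has an initial unit vector $|v_0\rangle\in\mathbb{C}^m$ and a unitary $m\times m$ matrix for each input symbol; on input $w$ the matrices are applied in order and the final state $|v_f\rangle$ is measured in the computational basis, observing $q_i$ with probability $|\langle q_i|v_f\rangle|^2$. A Las Vegas UFA has $Q$ partitioned into accepting, rejecting and neutral ("don't know") states; it recognizes $L$ with success probability $p$ if for every input the probability of observing a state giving the wrong answer is $0$ and that of a state giving the correct answer is at least $p$. *)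

theory Defs
  imports "Jordan_Normal_Form.Schur_Decomposition"
begin

text \<open>Strings over \<open>{0,1}\<close> are values of type \<open>bool list\<close>; exclusive or is \<open>\<noteq>\<close> on \<open>bool\<close>.
  Each pair \<open>(x, u)\<close> in \<open>bs\<close> is one block \<open>x\<^sub>i u\<^sub>i\<close>.\<close>

definition MODXOR :: "nat \<Rightarrow> bool list set" where
  "MODXOR k =
     {w0 @ concat (map (\<lambda>(x, u). x # u) bs) | w0 bs.
        length w0 < 2 * k \<and> bs \<noteq> [] \<and>
        (\<forall>(x, u) \<in> set bs. length u = 2 * k - 1) \<and>
        foldr (\<noteq>) (map fst bs) False}"

definition unitary_mat :: "nat \<Rightarrow> complex mat \<Rightarrow> bool" where
  "unitary_mat n U \<longleftrightarrow>
     U \<in> carrier_mat n n \<and> mat_adjoint U * U = 1\<^sub>m n \<and> U * mat_adjoint U = 1\<^sub>m n"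

text \<open>The states \<open>q\<^sub>1, \<dots>, q\<^sub>m\<close> are the indices \<open>0, \<dots>, m - 1\<close>. Every element of the type \<open>'a\<close>
  is an input symbol.\<close>

record 'a ufa =
  num_states :: nat
  init_vec :: "complex vec"
  step_mat :: "'a \<Rightarrow> complex mat"

definition is_ufa :: "('a, 'b) ufa_scheme \<Rightarrow> bool" where
  "is_ufa M \<longleftrightarrow>
     init_vec M \<in> carrier_vec (num_states M) \<and>
     init_vec M \<bullet>c init_vec M = 1 \<and>
     (\<forall>a. unitary_mat (num_states M) (step_mat M a))"

definition final_vec :: "('a, 'b) ufa_scheme \<Rightarrow> 'a list \<Rightarrow> complex vec" where
  "final_vec M w = foldl (\<lambda>v a. step_mat M a *\<^sub>v v) (init_vec M) w"

definition observe_prob :: "('a, 'b) ufa_scheme \<Rightarrow> 'a list \<Rightarrow> nat set \<Rightarrow> real" where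
  "observe_prob M w S = (\<Sum>i\<in>S. (cmod (final_vec M w $ i))\<^sup>2)"

record 'a lv_ufa = "'a ufa" +
  accepting :: "nat set"
  rejecting :: "nat set"
  neutral :: "nat set"

text \<open>As usual for such automata, blocks of the partition may be empty.\<close>

definition is_las_vegas_ufa :: "'a lv_ufa \<Rightarrow> bool" where
  "is_las_vegas_ufa M \<longleftrightarrow>
     is_ufa M \<and>
     accepting M \<union> rejecting M \<union> neutral M = {..<num_states M} \<and>
     accepting M \<inter> rejecting M = {} \<and>
     accepting M \<inter> neutral M = {} \<and>
     rejecting M \<inter> neutral M = {}"

definition las_vegas_recognizes :: "'a lv_ufa \<Rightarrow> 'a list set \<Rightarrow> real \<Rightarrow> bool" where
  "las_vegas_recognizes M L p \<longleftrightarrow>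
     (\<forall>w. (w \<in> L \<longrightarrow> observe_prob M w (rejecting M) = 0 \<and> observe_prob M w (accepting M) \<ge> p) \<and>
          (w \<notin> L \<longrightarrow> observe_prob M w (accepting M) = 0 \<and> observe_prob M w (rejecting M) \<ge> p))"

end

theory Submission
  imports Defs
begin

text \<open>
  For a string of length \<open>n\<close>, let the bit \<open>s\<^sub>c\<close> be the parity of the ones at positions (from 0) congruent to \<open>c\<close>
  modulo \<open>2k\<close>; the string is in the language iff \<open>s\<^sub>n\<close> is 1. Half of the probability weight carries the
  \<open>k\<close> bits \<open>s\<^sub>n, s\<^sub>n\<^sub>+\<^sub>2, s\<^sub>n\<^sub>+\<^sub>4, \<dots>\<close> as a basis state of an ``active'' half of the state set, the
  other half of it carries \<open>s\<^sub>n\<^sub>+\<^sub>1, s\<^sub>n\<^sub>+\<^sub>3, \<dots>\<close> in a ``passive'' half. Reading a symbol \<open>x\<close> adds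
  \<open>x\<close> to the first active bit, rotates the active register, and exchanges the two halves. This
  is a permutation of the basis states, and afterwards the bit that decides membership is again
  the first one of the active half. The passive states are the neutral ones.
\<close>

section \<open>Residue class parities\<close>

text \<open>The index is reduced inside, so that offsets such as \<open>length w + 2 * i\<close> may
  wrap around.\<close>

definition class_parity :: "nat \<Rightarrow> bool list \<Rightarrow> nat \<Rightarrow> bool" where
  "class_parity m w c \<longleftrightarrow> odd (card {p. p < length w \<and> w ! p \<and> p mod m = c mod m})"

lemma class_parity_Nil [simp]: "\<not> class_parity m [] c"
  by (simp add: class_parity_def)

lemma class_parity_mod_cong: "c mod m = d mod m \<Longrightarrow> class_parity m w c = class_parity m w d"
  by (simp add: class_parity_def)

lemma class_parity_snoc:
  "class_parity m (w @ [x]) c \<longleftrightarrow> class_parity m w c \<noteq> (x \<and> length w mod m = c mod m)"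
proof -
  let ?S = "{p. p < length w \<and> w ! p \<and> p mod m = c mod m}"
  have "{p. p < length (w @ [x]) \<and> (w @ [x]) ! p \<and> p mod m = c mod m} =
      (if x \<and> length w mod m = c mod m then insert (length w) ?S else ?S)"
    by (auto simp: nth_append less_Suc_eq)
  moreover have "finite ?S" "length w \<notin> ?S" by auto
  ultimately show ?thesis by (auto simp: class_parity_def)
qed

text \<open>Positions below \<open>m\<close> are their own residues, so none shares that of
  \<open>length w\<close>. Hence the prefix \<open>w0\<close> contributes nothing.\<close>

lemma class_parity_short:
  assumes "length w < m"
  shows "\<not> class_parity m w (length w)"
proof -
  have "{p. p < length w \<and> w ! p \<and> p mod m = length w mod m} = {}"
    using assms by auto
  then show ?thesis by (simp only: class_parity_def) simp
qed

lemma mod_add_neq: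
  fixes d m n :: nat
  assumes "0 < d" "d < m"
  shows "n mod m \<noteq> (n + d) mod m"
proof
  assume "n mod m = (n + d) mod m"
  then have "m dvd (n + d) - n" by (metis mod_eq_dvd_iff_nat le_add1)
  then show False using assms by (auto dest: dvd_imp_le)
qed

text \<open>The positions in \<open>u\<close> lie at distances 1 to \<open>m - 1\<close> from that
  of \<open>x\<close>, hence outside its class.\<close>

lemma class_parity_block:
  assumes "length u < m"
  shows "class_parity m (w @ x # u) (length w) \<longleftrightarrow> class_parity m w (length w) \<noteq> x"
  using assms
proof (induction u rule: rev_induct)
  case Nil
  show ?case by (simp add: class_parity_snoc)
next
  case (snoc y u)
  have "length w mod m \<noteq> (length w + Suc (length u)) mod m"
    using snoc.prems by (intro mod_add_neq) auto
  then show ?case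
    using snoc class_parity_snoc[of m "w @ x # u" y "length w"] by simp
qed

lemma foldr_xor_append:
  "foldr (\<noteq>) (xs @ ys) False \<longleftrightarrow> foldr (\<noteq>) xs False \<noteq> foldr (\<noteq>) ys False"
  by (induction xs) auto

text \<open>Blocks have length \<open>m\<close>, so every leading symbol \<open>x\<close> lies in
  the residue class of the total length.\<close>

lemma class_parity_blocks:
  assumes "0 < m" "length w0 < m" "\<forall>(x, u) \<in> set bs. length u = m - 1"
  defines "w \<equiv> w0 @ concat (map (\<lambda>(x, u). x # u) bs)"
  shows "class_parity m w (length w) \<longleftrightarrow> foldr (\<noteq>) (map fst bs) False"
  using assms(3) unfolding w_def
proof (induction bs rule: rev_induct)
  case Nil
  show ?case using class_parity_short[OF assms(2)] by simp
next
  case (snoc b bs)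
  obtain x u where b: "b = (x, u)" by (cases b)
  let ?v = "w0 @ concat (map (\<lambda>(x, u). x # u) bs)"
  have u: "length u = m - 1" using snoc.prems b by auto
  have "class_parity m (?v @ x # u) (length (?v @ x # u)) \<longleftrightarrow>
      class_parity m (?v @ x # u) (length ?v)"
  proof (rule class_parity_mod_cong)
    have "length (?v @ x # u) = length ?v + m" using u \<open>0 < m\<close> by simp
    then show "length (?v @ x # u) mod m = length ?v mod m" by (metis mod_add_self2)
  qed
  also have "\<dots> \<longleftrightarrow> class_parity m ?v (length ?v) \<noteq> x"
    using u \<open>0 < m\<close> by (intro class_parity_block) simp
  also have "class_parity m ?v (length ?v) \<longleftrightarrow> foldr (\<noteq>) (map fst bs) False"
    using snoc by auto
  also have "(foldr (\<noteq>) (map fst bs) False \<noteq> x) \<longleftrightarrow> foldr (\<noteq>) (map fst (bs @ [b])) False"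
    using foldr_xor_append[of "map fst bs" "[x]"] b by simp
  finally show ?case by (simp add: b del: length_append)
qed

text \<open>Blocks are cut off from the right end until fewer than \<open>m\<close> symbols remain;
  these form \<open>w0\<close>.\<close>

lemma block_decomposition_exists:
  assumes "0 < m"
  shows "\<exists>w0 bs. length w0 < m \<and> (\<forall>(x, u) \<in> set bs. length u = m - 1) \<and>
    w = w0 @ concat (map (\<lambda>(x, u). x # u) bs)"
proof (induction "length w" arbitrary: w rule: less_induct)
  case less
  show ?case
  proof (cases "length w < m")
    case True
    then show ?thesis by (intro exI[of _ w] exI[of _ "[]"]) simp
  next
    case False
    let ?v = "take (length w - m) w"
    obtain x u where xu: "drop (length w - m) w = x # u"
      using False assms by (cases "drop (length w - m) w") auto
    then have "length u = m - 1"
      using False by (metis diff_diff_cancel length_drop length_tl linorder_not_less list.sel(3))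
    moreover have "length ?v < length w" using False assms by simp
    then obtain w0 bs where "length w0 < m" "\<forall>(x, u) \<in> set bs. length u = m - 1"
        "?v = w0 @ concat (map (\<lambda>(x, u). x # u) bs)"
      using less[of ?v] by blast
    moreover have "w = ?v @ x # u" using xu by (metis append_take_drop_id)
    ultimately show ?thesis
      by (intro exI[of _ w0] exI[of _ "bs @ [(x, u)]"]) auto
  qed
qed

lemma MODXOR_iff_class_parity:
  assumes "0 < k"
  shows "w \<in> MODXOR k \<longleftrightarrow> class_parity (2 * k) w (length w)"
proof
  assume "w \<in> MODXOR k"
  then show "class_parity (2 * k) w (length w)"
    using class_parity_blocks[of "2 * k"] assms by (auto simp: MODXOR_def simp del: length_append)
next
  assume par: "class_parity (2 * k) w (length w)"
  obtain w0 bs where *: "length w0 < 2 * k" "\<forall>(x, u) \<in> set bs. length u = 2 * k - 1"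
      "w = w0 @ concat (map (\<lambda>(x, u). x # u) bs)"
    using block_decomposition_exists[of "2 * k" w] assms by auto
  then have "foldr (\<noteq>) (map fst bs) False"
    using class_parity_blocks[of "2 * k" w0 bs] par assms by simp
  \<comment> \<open>An empty exclusive or is \<open>False\<close>, so parity one forces at least one
    block.\<close>
  moreover from this have "bs \<noteq> []" by auto
  ultimately show "w \<in> MODXOR k" using * unfolding MODXOR_def by blast
qed

section \<open>Permutation matrices\<close>

definition basis_map_mat :: "nat \<Rightarrow> (nat \<Rightarrow> nat) \<Rightarrow> complex mat" where
  "basis_map_mat n f = mat n n (\<lambda>(i, j). if i = f j then 1 else 0)"

lemma basis_map_mat_carrier [simp]: "basis_map_mat n f \<in> carrier_mat n n"
  by (simp add: basis_map_mat_def)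

text \<open>The columns are the unit vectors at \<open>f j\<close>, orthonormal by injectivity; for
  square matrices a left inverse is also a right inverse.\<close>

lemma unitary_basis_map_mat:
  assumes "inj_on f {..<n}" "f ` {..<n} \<subseteq> {..<n}"
  shows "unitary_mat n (basis_map_mat n f)"
proof -
  let ?U = "basis_map_mat n f"
  have adj: "mat_adjoint ?U \<in> carrier_mat n n"
    by (simp add: mat_adjoint_def mat_of_rows_def basis_map_mat_def)
  have "mat_adjoint ?U * ?U = 1\<^sub>m n"
  proof (rule eq_matI)
    fix i j assume "i < dim_row (1\<^sub>m n :: complex mat)" "j < dim_col (1\<^sub>m n :: complex mat)"
    then have ij: "i < n" "j < n" by auto
    then have "(mat_adjoint ?U * ?U) $$ (i, j) =
        (\<Sum>l = 0..<n. (if l = f i then 1 else 0) * (if l = f j then 1 else 0))"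
      using adj
      by (auto simp: scalar_prod_def mat_adjoint_def mat_of_rows_def basis_map_mat_def
          intro!: sum.cong)
    also have "\<dots> = (if f i = f j then 1 else 0)"
      using ij assms(2) by (auto simp: if_distrib cong: if_cong)
    also have "\<dots> = 1\<^sub>m n $$ (i, j)"
      using ij assms(1) by (auto dest: inj_onD)
    finally show "(mat_adjoint ?U * ?U) $$ (i, j) = 1\<^sub>m n $$ (i, j)" .
  qed (use adj in \<open>auto simp: basis_map_mat_def\<close>)
  moreover from this have "?U * mat_adjoint ?U = 1\<^sub>m n"
    using mat_mult_left_right_inverse adj basis_map_mat_carrier by blast
  ultimately show ?thesis by (simp add: unitary_mat_def)
qed

lemma basis_map_mat_unit_vec:
  assumes "j < n"
  shows "basis_map_mat n f *\<^sub>v unit_vec n j = unit_vec n (f j)"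
  using assms by (intro eq_vecI) 
    (auto simp: basis_map_mat_def unit_vec_def scalar_prod_def if_distrib[of "(*) _"] cong: if_cong)

section \<open>The register transition\<close>

text \<open>The updated bit re-enters at the top because its class recurs only \<open>2 * k\<close>
  symbols later, after all others in the register. For \<open>r < 2 ^ k\<close> the two operands of
  \<open>or\<close> have disjoint bits.\<close>

definition rotate_xor :: "nat \<Rightarrow> bool \<Rightarrow> nat \<Rightarrow> nat" where
  "rotate_xor k x r =
    Bit_Operations.or (drop_bit 1 r) (push_bit (k - 1) (of_bool (odd r \<noteq> x)))"

lemma not_bit_ge: "r < 2 ^ k \<Longrightarrow> k \<le> i \<Longrightarrow> \<not> bit (r :: nat) i"
  by (metis bit_take_bit_iff linorder_not_less take_bit_nat_eq_self)

lemma bit_rotate_xor: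
  "bit (rotate_xor k x r) i \<longleftrightarrow> bit r (Suc i) \<or> i = k - 1 \<and> odd r \<noteq> x"
  by (auto simp: rotate_xor_def bit_or_iff bit_drop_bit_eq bit_push_bit_iff bit_Suc_0_iff)

lemma rotate_xor_less:
  assumes "0 < k" "r < 2 ^ k"
  shows "rotate_xor k x r < 2 ^ k"
proof -
  have "n < k" if "bit r (Suc n)" for n
    using that not_bit_ge[OF assms(2), of "Suc n"] by (cases "n < k") auto
  then have "take_bit k (rotate_xor k x r) = rotate_xor k x r"
    using assms(1)
    by (intro bit_eqI) (auto simp: bit_take_bit_iff bit_rotate_xor)
  then show ?thesis by (simp add: take_bit_nat_eq_self_iff)
qed

lemma inj_on_rotate_xor:
  assumes "0 < k"
  shows "inj_on (rotate_xor k x) {..<2 ^ k}"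
proof (rule inj_onI)
  fix r s :: nat
  assume rs: "r \<in> {..<2 ^ k}" "s \<in> {..<2 ^ k}" and eq: "rotate_xor k x r = rotate_xor k x s"
  have high: "\<not> bit r k" "\<not> bit s k" using rs not_bit_ge by auto
  have step: "(bit r (Suc i) \<or> i = k - 1 \<and> odd r \<noteq> x) \<longleftrightarrow> (bit s (Suc i) \<or> i = k - 1 \<and> odd s \<noteq> x)" for i
    using eq bit_rotate_xor by metis
  \<comment> \<open>Bit \<open>k\<close> vanishes in both numbers, so the top bit of the result
    reveals the parity of the argument.\<close>
  have low: "odd r = odd s" using step[of "k - 1"] high assms by auto
  show "r = s"
  proof (rule bit_eqI)
    fix i
    show "bit r i = bit s i"
    proof (cases i)
      case 0
      then show ?thesis using low by (simp add: bit_0)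
    next
      case (Suc j)
      then show ?thesis using step[of j] high assms by (cases "j = k - 1") auto
    qed
  qed
qed

text \<open>States below \<open>2 ^ k\<close> are active, the others are passive.\<close>

definition swap_step :: "nat \<Rightarrow> bool \<Rightarrow> nat \<Rightarrow> nat" where
  "swap_step k x i = (if i < 2 ^ k then 2 ^ k + rotate_xor k x i else i - 2 ^ k)"

lemma swap_step_less:
  assumes "0 < k" "i < 2 * 2 ^ k"
  shows "swap_step k x i < 2 * 2 ^ k"
  using assms rotate_xor_less[of k i x] by (auto simp: swap_step_def)

lemma inj_on_swap_step:
  assumes "0 < k"
  shows "inj_on (swap_step k x) {..<2 * 2 ^ k}"
proof (rule inj_onI)
  fix i j :: nat
  assume ij: "i \<in> {..<2 * 2 ^ k}" "j \<in> {..<2 * 2 ^ k}" and eq: "swap_step k x i = swap_step k x j"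
  \<comment> \<open>The half containing the image determines the half containing the
    argument.\<close>
  have active: "2 ^ k \<le> swap_step k x l \<longleftrightarrow> l < 2 ^ k" if "l < 2 * 2 ^ k" for l
    using that by (auto simp: swap_step_def)
  then have same: "i < 2 ^ k \<longleftrightarrow> j < 2 ^ k" using ij eq by (metis lessThan_iff)
  show "i = j"
  proof (cases "i < 2 ^ k")
    case True
    then have "rotate_xor k x i = rotate_xor k x j" using same eq by (simp add: swap_step_def)
    then show ?thesis using inj_on_rotate_xor[OF assms] True same by (simp add: inj_on_def)
  next
    case False
    then show ?thesis using same eq by (simp add: swap_step_def)
  qed
qed

text \<open>Classical trace of the two superposed basis states: first the active register, then the
  passive one.\<close>

definition registers :: "nat \<Rightarrow> bool list \<Rightarrow> nat \<times> nat" where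
  "registers k w = foldl (\<lambda>(a, b) x. (b, rotate_xor k x a)) (0, 0) w"

lemma registers_Nil: "registers k [] = (0, 0)"
  by (simp add: registers_def)

lemma registers_snoc:
  "registers k (w @ [x]) = (snd (registers k w), rotate_xor k x (fst (registers k w)))"
  by (simp add: registers_def split_def)

lemma registers_less:
  assumes "0 < k"
  shows "fst (registers k w) < 2 ^ k" "snd (registers k w) < 2 ^ k"
proof -
  have "fst (registers k w) < 2 ^ k \<and> snd (registers k w) < 2 ^ k"
    by (induction w rule: rev_induct)
      (simp_all add: registers_Nil registers_snoc rotate_xor_less assms)
  then show "fst (registers k w) < 2 ^ k" "snd (registers k w) < 2 ^ k" by auto
qed

text \<open>Both claims need a joint induction, since each step exchanges the roles of the
  registers.\<close>

lemma registers_bits: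
  assumes "0 < k" "i < k"
  shows "bit (fst (registers k w)) i \<longleftrightarrow> class_parity (2 * k) w (length w + 2 * i)"
    and "bit (snd (registers k w)) i \<longleftrightarrow> class_parity (2 * k) w (length w + 1 + 2 * i)"
proof -
  have "\<forall>i<k. (bit (fst (registers k w)) i \<longleftrightarrow> class_parity (2 * k) w (length w + 2 * i)) \<and>
      (bit (snd (registers k w)) i \<longleftrightarrow> class_parity (2 * k) w (length w + 1 + 2 * i))"
  proof (induction w rule: rev_induct)
    case Nil
    show ?case by (simp add: registers_Nil)
  next
    case (snoc x w)
    let ?n = "length w" and ?a = "fst (registers k w)"
    \<comment> \<open>The new symbol sits at position \<open>?n\<close>, so classes at offsets
      strictly between 0 and \<open>2 * k\<close> are unaffected.\<close>
    note other = mod_add_neq[of _ "2 * k" ?n]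
    show ?case
    proof (intro allI impI conjI)
      fix i assume "i < k"
      then show "bit (fst (registers k (w @ [x]))) i \<longleftrightarrow>
          class_parity (2 * k) (w @ [x]) (length (w @ [x]) + 2 * i)"
        using snoc other[of "1 + 2 * i"] by (simp add: registers_snoc class_parity_snoc)
    next
      fix i assume "i < k"
      show "bit (snd (registers k (w @ [x]))) i \<longleftrightarrow>
          class_parity (2 * k) (w @ [x]) (length (w @ [x]) + 1 + 2 * i)"
      proof (cases "i = k - 1")
        \<comment> \<open>The top bit belongs to offset \<open>2 * k\<close>, that is, to the class
          of \<open>?n\<close> itself, the only one that \<open>x\<close> changes.\<close>
        case True
        have "length (w @ [x]) + 1 + 2 * i = ?n + 2 * k" using True assms(1) by simp
        then have "class_parity (2 * k) (w @ [x]) (length (w @ [x]) + 1 + 2 * i) \<longleftrightarrow>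
            class_parity (2 * k) w ?n \<noteq> x"
          using class_parity_mod_cong[of "?n + 2 * k" "2 * k" ?n w]
          by (simp only: class_parity_snoc) simp
        moreover have "\<not> bit ?a k" 
          by (rule not_bit_ge[OF registers_less(1)[OF assms(1)] order_refl])
        moreover have "odd ?a \<longleftrightarrow> class_parity (2 * k) w ?n"
          using snoc assms(1) by (force simp: bit_0)
        ultimately show ?thesis
          using True assms(1) by (simp add: registers_snoc bit_rotate_xor)
      next
        case False
        then have "Suc i < k" using \<open>i < k\<close> by simp
        then have "bit ?a (Suc i) \<longleftrightarrow> class_parity (2 * k) w (?n + 2 * Suc i)"
          using snoc by blast
        then show ?thesis
          using False \<open>Suc i < k\<close> other[of "2 + 2 * i"]
          by (simp add: registers_snoc bit_rotate_xor class_parity_snoc)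
      qed
    qed
  qed
  then show "bit (fst (registers k w)) i \<longleftrightarrow> class_parity (2 * k) w (length w + 2 * i)"
    and "bit (snd (registers k w)) i \<longleftrightarrow> class_parity (2 * k) w (length w + 1 + 2 * i)"
    using assms(2) by auto
qed

section \<open>The automaton\<close>

text \<open>Initially both registers are zero, the passive one shifted by \<open>2 ^ k\<close>. The
  low bit of the active register decides the answer.\<close>

definition modxor_ufa :: "nat \<Rightarrow> bool lv_ufa" where
  "modxor_ufa k =
    \<lparr>num_states = 2 * 2 ^ k,
     init_vec = complex_of_real (1 / sqrt 2) \<cdot>\<^sub>v
       (unit_vec (2 * 2 ^ k) 0 + unit_vec (2 * 2 ^ k) (2 ^ k)),
     step_mat = (\<lambda>x. basis_map_mat (2 * 2 ^ k) (swap_step k x)),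
     accepting = {i. i < 2 ^ k \<and> odd i},
     rejecting = {i. i < 2 ^ k \<and> even i},
     neutral = {2 ^ k..<2 * 2 ^ k}\<rparr>"

lemma final_vec_modxor_ufa:
  assumes "0 < k"
  shows "final_vec (modxor_ufa k) w = complex_of_real (1 / sqrt 2) \<cdot>\<^sub>v
    (unit_vec (2 * 2 ^ k) (fst (registers k w)) + unit_vec (2 * 2 ^ k) (2 ^ k + snd (registers k w)))"
proof (induction w rule: rev_induct)
  case Nil
  show ?case by (simp add: final_vec_def modxor_ufa_def registers_Nil)
next
  case (snoc x w)
  let ?N = "2 * 2 ^ k :: nat" and ?U = "basis_map_mat (2 * 2 ^ k) (swap_step k x)"
  let ?a = "fst (registers k w)" and ?b = "snd (registers k w)"
  note less = registers_less[OF assms, of w]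
  have "final_vec (modxor_ufa k) (w @ [x]) = ?U *\<^sub>v final_vec (modxor_ufa k) w"
    by (simp add: final_vec_def modxor_ufa_def)
  also have "\<dots> = complex_of_real (1 / sqrt 2) \<cdot>\<^sub>v
      (?U *\<^sub>v unit_vec ?N ?a + ?U *\<^sub>v unit_vec ?N (2 ^ k + ?b))"
    unfolding snoc
    by (simp add: mult_mat_vec[OF basis_map_mat_carrier]
        mult_add_distrib_mat_vec[OF basis_map_mat_carrier])
  also have "?U *\<^sub>v unit_vec ?N ?a = unit_vec ?N (2 ^ k + rotate_xor k x ?a)"
    using less by (simp add: basis_map_mat_unit_vec swap_step_def)
  also have "?U *\<^sub>v unit_vec ?N (2 ^ k + ?b) = unit_vec ?N ?b"
    using less by (simp add: basis_map_mat_unit_vec swap_step_def)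
  \<comment> \<open>The halves have changed places; reordering puts the new active vector
    first.\<close>
  also have "unit_vec ?N (2 ^ k + rotate_xor k x ?a) + unit_vec ?N ?b =
      (unit_vec ?N ?b + unit_vec ?N (2 ^ k + rotate_xor k x ?a) :: complex vec)"
    by (intro comm_add_vec[of _ ?N]) auto
  finally show ?case by (simp add: registers_snoc)
qed

text \<open>The passive summand sits at an index of at least \<open>2 ^ k\<close>, so only the
  active one, of squared amplitude one half, can be observed in \<open>S\<close>.\<close>

lemma observe_prob_active:
  assumes "0 < k" "S \<subseteq> {..<2 ^ k}"
  shows "observe_prob (modxor_ufa k) w S = (if fst (registers k w) \<in> S then 1 / 2 else 0)"
proof -
  have "finite S" using assms(2) finite_subset by blast
  have "(cmod (final_vec (modxor_ufa k) w $ i))\<^sup>2 = (if fst (registers k w) = i then 1 / 2 else 0)"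
    if "i \<in> S" for i
    using that assms(2) registers_less[OF assms(1), of w]
    by (auto simp: final_vec_modxor_ufa[OF assms(1)] norm_divide power_divide)
  then have "observe_prob (modxor_ufa k) w S =
      (\<Sum>i\<in>S. if fst (registers k w) = i then 1 / 2 else 0)"
    by (simp add: observe_prob_def)
  then show ?thesis using \<open>finite S\<close> by simp
qed

lemma is_las_vegas_modxor_ufa:
  assumes "0 < k"
  shows "is_las_vegas_ufa (modxor_ufa k)"
proof -
  have "unitary_mat (2 * 2 ^ k) (basis_map_mat (2 * 2 ^ k) (swap_step k x))" for x
    using inj_on_swap_step[OF assms] swap_step_less[OF assms]
    by (intro unitary_basis_map_mat) auto
  moreover have "init_vec (modxor_ufa k) \<bullet>c init_vec (modxor_ufa k) = 1"
  proof -
    let ?N = "2 * 2 ^ k :: nat" and ?c = "complex_of_real (1 / sqrt 2)"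
    let ?v = "unit_vec ?N 0 + unit_vec ?N (2 ^ k) :: complex vec"
    have "conjugate (?c \<cdot>\<^sub>v ?v) = ?c \<cdot>\<^sub>v ?v"
      by (intro eq_vecI) (auto simp: unit_vec_def)
    \<comment> \<open>The cross terms vanish because the indices 0 and \<open>2 ^ k\<close>
      differ.\<close>
    moreover have "?v \<bullet> ?v = 2"
      by (simp add: scalar_prod_add_distrib[of _ ?N] add_scalar_prod_distrib[of _ ?N])
    moreover have "?c * ?c = 1 / 2"
      by (simp flip: of_real_mult)
    ultimately show ?thesis
      by (simp add: modxor_ufa_def)
  qed
  ultimately show ?thesis
    by (auto simp: is_las_vegas_ufa_def is_ufa_def modxor_ufa_def)
qed

theorem theorem11:
  fixes k :: nat
  assumes "k > 0"
  shows "\<exists>M :: bool lv_ufa. is_las_vegas_ufa M \<and> num_states M = 2 * 2 ^ k \<and>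
           las_vegas_recognizes M (MODXOR k) (1 / 2)"
proof (intro exI conjI)
  show "is_las_vegas_ufa (modxor_ufa k)" using is_las_vegas_modxor_ufa assms .
  show "num_states (modxor_ufa k) = 2 * 2 ^ k" by (simp add: modxor_ufa_def)
  \<comment> \<open>The second \<open>assms\<close> instantiates \<open>i < k\<close> with
    \<open>i = 0\<close>, selecting the class of \<open>length w\<close>.\<close>
  have "odd (fst (registers k w)) \<longleftrightarrow> w \<in> MODXOR k" for w
    using registers_bits(1)[OF assms assms, of w] MODXOR_iff_class_parity[OF assms]
    by (simp add: bit_0)
  moreover have "accepting (modxor_ufa k) = {i. i < 2 ^ k \<and> odd i}"
      "rejecting (modxor_ufa k) = {i. i < 2 ^ k \<and> even i}"
    by (simp_all add: modxor_ufa_def)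
  ultimately show "las_vegas_recognizes (modxor_ufa k) (MODXOR k) (1 / 2)"
    using registers_less(1)[OF assms]
    by (auto simp: las_vegas_recognizes_def observe_prob_active[OF assms] subset_iff)
qed

end
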